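(* Let $n\ge1$. For any sequence of non-negative weights $\mathbf{w}=(w_i)_{i\in\{1,\dots,n\}}$ (not all zero), the associated Weighted ERM policy $\pi=\pi^{\mathbf{w}}$ is a counting policy. Furthermore, its counting function $\kappa^\pi$ is given, for every $\mathbf{b}\in\{0,1\}^n$, by $$\kappa^\pi(\mathbf{b})=\begin{cases}1&\text{if }\dfrac{\sum_{i=1}^n w_i b_i}{\sum_{i=1}^n w_i}\ge\dfrac{c_u}{c_u+c_o},\\[2mm]0&\text{otherwise.}\end{cases}$$
   Context: Let $\mathcal{Y}=[0,1]$ and let $c_u,c_o>0$ be costs with $c_u+c_o=1$. Contexts $\mathbf{x}=(x_0,\dots,x_n)$ in a set $\mathcal{X}$ are fixed (weights may depend on them). Weighted ERM policy with weights $\mathbf{w}$: the deterministic policy mapping $\mathbf{y}=(y_1,\dots,y_n)\in\mathcal{Y}^n$ to $$\pi^{\mathbf{w}}(\mathbf{x},\mathbf{y})=\inf\Big\{a:\ \frac{\sum_{i=1}^n w_i\mathbf{1}\{y_i\le a\}}{\sum_{j=1}^n w_j}\ge\frac{c_u}{c_u+c_o}\Big\}.$$ Counting policy: a deterministic policy $\pi$ (mapping $\mathbf{y}\in\mathcal{Y}^n$ to $\pi(\mathbf{x},\mathbf{y})\in\mathcal{Y}$) is a counting policy if there is a function $\kappa^\pi:\{0,1\}^n\to\{0,1\}$ (possibly depending on the fixed $\mathbf{x}$), called its counting function, such that for every $y\in[0,1]$ and every $\mathbf{y}\in\mathcal{Y}^n$, $$\mathbf{1}\{\pi(\mathbf{x},\mathbf{y})\le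 y\}=\kappa^\pi(\mathbf{1}\{y_1\le y\},\dots,\mathbf{1}\{y_n\le y\}).$$ *)

theory Defs
  imports Complex_Main "HOL-Library.FuncSet"
begin

text \<open>
  A tuple indexed by \<open>{1..n}\<close> is an extensional function on \<open>{1..n}\<close>; a tuple of
  contexts \<open>(x 0, \<dots>, x n)\<close> is one on \<open>{0..n}\<close>.  Policies and weights take the
  tuple of contexts as their first argument, so both may depend on it.
\<close>

abbreviation outcome_space :: "real set" where
  "outcome_space \<equiv> {0..1}"

abbreviation samples :: "nat \<Rightarrow> (nat \<Rightarrow> real) set" where
  "samples n \<equiv> {1..n} \<rightarrow>\<^sub>E outcome_space"

abbreviation bit_vectors :: "nat \<Rightarrow> (nat \<Rightarrow> nat) set" where
  "bit_vectors n \<equiv> {1..n} \<rightarrow>\<^sub>E {0, 1}"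

type_synonym 'x policy = "(nat \<Rightarrow> 'x) \<Rightarrow> (nat \<Rightarrow> real) \<Rightarrow> real"

text \<open>
  The infimum ranges over all real \<open>a\<close>.  For non-negative weights that are not all
  zero, positive costs and \<open>y \<in> samples n\<close>, the set contains \<open>1\<close> and is bounded below
  by \<open>0\<close>, so \<open>Inf\<close> is the genuine infimum.
\<close>

definition weighted_erm ::
  "nat \<Rightarrow> real \<Rightarrow> real \<Rightarrow> ((nat \<Rightarrow> 'x) \<Rightarrow> nat \<Rightarrow> real) \<Rightarrow> 'x policy" where
  "weighted_erm n c\<^sub>u c\<^sub>o w x y =
     Inf {a. (\<Sum>i = 1..n. w x i * of_bool (y i \<le> a)) / (\<Sum>j = 1..n. w x j)
               \<ge> c\<^sub>u / (c\<^sub>u + c\<^sub>o)}"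

definition is_counting_function ::
  "nat \<Rightarrow> (nat \<Rightarrow> 'x) \<Rightarrow> 'x policy \<Rightarrow> ((nat \<Rightarrow> nat) \<Rightarrow> nat) \<Rightarrow> bool" where
  "is_counting_function n x \<pi> \<kappa> \<longleftrightarrow>
     \<kappa> \<in> bit_vectors n \<rightarrow> {0, 1} \<and>
     (\<forall>t \<in> outcome_space. \<forall>y \<in> samples n.
        of_bool (\<pi> x y \<le> t) = \<kappa> (\<lambda>i\<in>{1..n}. of_bool (y i \<le> t)))"

definition is_counting_policy :: "nat \<Rightarrow> (nat \<Rightarrow> 'x) \<Rightarrow> 'x policy \<Rightarrow> bool" where
  "is_counting_policy n x \<pi> \<longleftrightarrow>
     \<pi> x \<in> samples n \<rightarrow> outcome_space \<and> (\<exists>\<kappa>. is_counting_function n x \<pi> \<kappa>)"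

end

theory Submission
  imports Defs
begin

text \<open>
  The weighted empirical distribution function is a nondecreasing right-continuous step
  function, so the infimum defining the weighted ERM policy is attained; hence the policy is at
  most \<open>t\<close> exactly when the distribution function at \<open>t\<close> reaches the critical ratio, which only
  depends on the bits \<open>y i \<le> t\<close>.  The counting function is unique because every bit vector
  \<open>b\<close> arises from the sample \<open>y i = 1 - b i\<close> at \<open>t = 0\<close>.
\<close>

text \<open>From right to left, the infimum is a lower bound. From left to right, monotonicity of
  the distribution function, which rests on \<open>v \<ge> 0\<close>, reduces the claim to the
  infimum \<open>m\<close> being attained. Nonemptiness and boundedness make \<open>Inf\<close> a
  genuine infimum.\<close>

lemma weighted_quantile_le_iff:
  fixes v y :: "'i \<Rightarrow> real" and q t :: real
  assumes "finite I" and v: "\<And>i. i \<in> I \<Longrightarrow> v i \<ge> 0"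
    and ne: "{a. q \<le> (\<Sum>i\<in>I. v i * of_bool (y i \<le> a)) / sum v I} \<noteq> {}"
    and bdd: "bdd_below {a. q \<le> (\<Sum>i\<in>I. v i * of_bool (y i \<le> a)) / sum v I}"
  shows "Inf {a. q \<le> (\<Sum>i\<in>I. v i * of_bool (y i \<le> a)) / sum v I} \<le> t \<longleftrightarrow>
    q \<le> (\<Sum>i\<in>I. v i * of_bool (y i \<le> t)) / sum v I"
proof -
  define F where "F a = (\<Sum>i\<in>I. v i * of_bool (y i \<le> a)) / sum v I" for a
  define m where "m = Inf {a. q \<le> F a}"
  have F_mono: "F a \<le> F b" if "a \<le> b" for a b
    unfolding F_def using that v
    by (intro divide_right_mono sum_mono sum_nonneg mult_left_mono) auto
  \<comment> \<open>No jump of \<open>F\<close> lies strictly between \<open>m\<close> and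
    \<open>d\<close>. The extra element \<open>m + 1\<close> keeps the set nonempty when no
    \<open>y i\<close> exceeds \<open>m\<close>.\<close>
  define d where "d = Min (insert (m + 1) (y ` {i \<in> I. m < y i}))"
  have "m < d" and d: "\<And>i. i \<in> I \<Longrightarrow> m < y i \<Longrightarrow> d \<le> y i"
    using \<open>finite I\<close> by (auto simp: d_def)
  obtain a where a: "q \<le> F a" "a < d"
    using cInf_lessD[of "{a. q \<le> F a}" d] ne \<open>m < d\<close> by (auto simp: m_def F_def)
  have "m \<le> a"
    using a bdd by (auto simp: m_def F_def intro: cInf_lower)
  \<comment> \<open>Since \<open>a\<close> lies in \<open>[m, d)\<close>, no \<open>y i\<close>
    separates \<open>m\<close> from \<open>a\<close>.\<close>
  have "y i \<le> a \<longleftrightarrow> y i \<le> m" if "i \<in> I" for i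
    using d[OF that] \<open>m \<le> a\<close> \<open>a < d\<close> by linarith
  then have "F a = F m"
    by (simp add: F_def cong: sum.cong)
  with a have m: "q \<le> F m" by simp
  have "m \<le> t \<longleftrightarrow> q \<le> F t"
  proof
    assume "m \<le> t"
    from F_mono[OF this] m show "q \<le> F t" by simp
  next
    assume "q \<le> F t"
    then show "m \<le> t"
      using bdd by (auto simp: m_def F_def intro: cInf_lower)
  qed
  then show ?thesis by (simp add: m_def F_def)
qed

theorem proposition4:
  fixes n :: nat and c\<^sub>u c\<^sub>o :: real
    and X :: "'x set" and x :: "nat \<Rightarrow> 'x"
    and w :: "(nat \<Rightarrow> 'x) \<Rightarrow> nat \<Rightarrow> real"
  assumes "n \<ge> 1"
    and "c\<^sub>u > 0" and "c\<^sub>o > 0" and "c\<^sub>u + c\<^sub>o = 1"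
    and "x \<in> {0..n} \<rightarrow>\<^sub>E X"
    and "\<forall>i \<in> {1..n}. w x i \<ge> 0"
    and "\<exists>i \<in> {1..n}. w x i \<noteq> 0"
  shows "is_counting_policy n x (weighted_erm n c\<^sub>u c\<^sub>o w) \<and>
    (\<forall>\<kappa>. is_counting_function n x (weighted_erm n c\<^sub>u c\<^sub>o w) \<kappa> \<longrightarrow>
      (\<forall>b \<in> bit_vectors n.
        \<kappa> b = (if (\<Sum>i = 1..n. w x i * real (b i)) / (\<Sum>i = 1..n. w x i)
                    \<ge> c\<^sub>u / (c\<^sub>u + c\<^sub>o)
               then 1 else 0)))"
proof -
  define q where "q = c\<^sub>u / (c\<^sub>u + c\<^sub>o)"
  define S where
    "S y = {a. q \<le> (\<Sum>i = 1..n. w x i * of_bool (y i \<le> a)) / (\<Sum>j = 1..n. w x j)}" for y :: "nat \<Rightarrow> real"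
  define K where
    "K b = (if q \<le> (\<Sum>i = 1..n. w x i * real (b i)) / (\<Sum>i = 1..n. w x i) then 1 else 0 :: nat)"
    for b :: "nat \<Rightarrow> nat"
  let ?\<pi> = "weighted_erm n c\<^sub>u c\<^sub>o w"
  \<comment> \<open>\<open>q \<le> 1\<close> puts \<open>1\<close> into \<open>S y\<close>, where
    all the weight is counted; \<open>0 < q\<close> keeps negative \<open>a\<close> out, where none
    is.\<close>
  have q: "0 < q" "q \<le> 1"
    using assms(2-4) by (auto simp: q_def)
  have W: "(\<Sum>i = 1..n. w x i) > 0"
    using assms(6,7) by (metis finite_atLeastAtMost order_le_less sum_pos2)
  have erm: "?\<pi> x y = Inf (S y)" for y
    by (simp add: weighted_erm_def S_def q_def)
  have one_mem: "1 \<in> S y" if "y \<in> samples n" for y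
  proof -
    have "(\<Sum>i = 1..n. w x i * of_bool (y i \<le> 1)) = (\<Sum>i = 1..n. w x i)"
      using that by (intro sum.cong) (auto simp: PiE_iff)
    then show ?thesis using W q by (simp add: S_def)
  qed
  have nonneg: "0 \<le> a" if "y \<in> samples n" and "a \<in> S y" for y a
  proof (rule ccontr)
    assume "\<not> 0 \<le> a"
    moreover have "0 \<le> y i" if "i \<in> {1..n}" for i
      using \<open>y \<in> samples n\<close> that by (auto simp: PiE_iff)
    ultimately have "\<not> y i \<le> a" if "i \<in> {1..n}" for i
      using that by fastforce
    then have "(\<Sum>i = 1..n. w x i * of_bool (y i \<le> a)) = 0"
      by (intro sum.neutral) auto
    then show False using \<open>a \<in> S y\<close> q by (simp add: S_def)
  qed
  have bdd: "bdd_below (S y)" if "y \<in> samples n" for y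
    using nonneg[OF that] by (rule bdd_belowI)
  have erm_le_iff: "?\<pi> x y \<le> t \<longleftrightarrow> t \<in> S y" if "y \<in> samples n" for y t
    unfolding erm using weighted_quantile_le_iff[of "{1..n}" "w x" q y t]
      one_mem[OF that] bdd[OF that] assms(6) by (auto simp: S_def)
  have "?\<pi> x y \<in> outcome_space" if "y \<in> samples n" for y
  proof -
    have "?\<pi> x y \<le> 1"
      using erm_le_iff one_mem that by blast
    moreover have "0 \<le> ?\<pi> x y"
      using nonneg[OF that] one_mem[OF that] unfolding erm by (intro cInf_greatest) auto
    ultimately show ?thesis by simp
  qed
  \<comment> \<open>This holds for every real \<open>t\<close>, since membership of \<open>t\<close>
    in \<open>S y\<close> only involves the bits at indices in \<open>{1..n}\<close>.\<close>
  moreover have count: "of_bool (?\<pi> x y \<le> t) = K (\<lambda>i\<in>{1..n}. of_bool (y i \<le> t))"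
    if "y \<in> samples n" for y t
    using erm_le_iff[OF that, of t] by (simp add: K_def S_def)
  then have "is_counting_function n x ?\<pi> K"
    by (auto simp: is_counting_function_def K_def)
  moreover have "\<kappa> b = K b" if \<kappa>: "is_counting_function n x ?\<pi> \<kappa>" and b: "b \<in> bit_vectors n" for \<kappa> b
  proof -
    define y where "y = (\<lambda>i\<in>{1..n}. 1 - real (b i))"
    have bit: "b i = 0 \<or> b i = 1" if "i \<in> {1..n}" for i
      using b that by (auto simp: PiE_iff)
    have y: "y \<in> samples n"
      using bit by (force simp: y_def)
    \<comment> \<open>A bit 1 becomes the outcome 0 and a bit 0 the outcome 1, so the threshold 0
      recovers \<open>b\<close>. Off \<open>{1..n}\<close> both sides are
      \<open>undefined\<close>.\<close>
    have "(\<lambda>i\<in>{1..n}. of_bool (y i \<le> 0)) = b"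
    proof (rule extensionalityI)
      show "b \<in> extensional {1..n}" using b by (simp add: PiE_iff)
    qed (use bit in \<open>force simp: y_def\<close>)+
    with count[OF y, of 0] \<kappa> y show ?thesis
      by (auto simp: is_counting_function_def)
  qed
  ultimately show ?thesis
    by (auto simp: is_counting_policy_def K_def q_def)
qed

end
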